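(* For the probability measure $P:=\frac{149}{200}\delta_1+\frac1{200}\delta_2+\sum_{j=3}^\infty\frac1{2^j}\delta_j$, the optimal set of five-means is given by $$\{1,\,Av[2,3],\,4,\,Av[5,6],\,Av[7,\infty)\}\quad\text{or}\quad\{1,\,Av[2,3],\,Av[4,5],\,Av[6,7],\,Av[8,\infty)\},$$ with quantization error $V_5(P)=\frac{29}{624}$.
   Context: $\delta_x$ denotes the Dirac measure at $x\in\mathbb R$. For a Borel probability measure $P$ on $\mathbb R$ and a nonempty finite set $\alpha\subset\mathbb R$, the distortion error is $V(P;\alpha)=\int\min_{a\in\alpha}|x-a|^2\,dP(x)$. The $n$th quantization error is $V_n(P)=\inf\{V(P;\alpha):\alpha\subset\mathbb R,\ 1\le\mathrm{card}(\alpha)\le n\}$. An optimal set of $n$-means for $P$ is a set $\alpha$ with at most $n$ points for which this infimum is attained. With $p_m=P(\{m\})$ and $i\le\ell$ positive integers, $Av[i,\ell]=\frac{\sum_{m=i}^{\ell}p_m m}{\sum_{m=i}^{\ell}p_m}$ and $Av[i,\infty)=\frac{\sum_{m=i}^{\infty}p_m m}{\sum_{m=i}^{\infty}p_m}$. *)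

theory Defs
  imports "HOL-Probability.Probability"
begin

text \<open>The distortion error of a Borel probability measure on the line may be infinite, so it and
  the quantization error take values in \<^typ>\<open>ennreal\<close>.\<close>

definition distortion :: "real measure \<Rightarrow> real set \<Rightarrow> ennreal" where
  "distortion P \<alpha> = (\<integral>\<^sup>+ x. ennreal (Min ((\<lambda>a. \<bar>x - a\<bar>\<^sup>2) ` \<alpha>)) \<partial>P)"

text \<open>For infinite sets \<^const>\<open>card\<close> is 0, so \<open>1 \<le> card \<alpha>\<close> says that
  \<open>\<alpha>\<close> is finite and nonempty.\<close>

definition quantization_error :: "real measure \<Rightarrow> nat \<Rightarrow> ennreal" where
  "quantization_error P n = (INF \<alpha> \<in> {\<alpha>. 1 \<le> card \<alpha> \<and> card \<alpha> \<le> n}. distortion P \<alpha>)"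

definition optimal_means :: "real measure \<Rightarrow> nat \<Rightarrow> real set \<Rightarrow> bool" where
  "optimal_means P n \<alpha> \<longleftrightarrow>
     1 \<le> card \<alpha> \<and> card \<alpha> \<le> n \<and> distortion P \<alpha> = quantization_error P n"

definition Av :: "real measure \<Rightarrow> nat \<Rightarrow> nat \<Rightarrow> real" where
  "Av P i l =
     (\<Sum>m=i..l. measure P {real m} * real m) / (\<Sum>m=i..l. measure P {real m})"

definition Av_inf :: "real measure \<Rightarrow> nat \<Rightarrow> real" where
  "Av_inf P i =
     (\<Sum>k. measure P {real (i + k)} * real (i + k)) / (\<Sum>k. measure P {real (i + k)})"

abbreviation dirac :: "real \<Rightarrow> real measure" where
  "dirac x \<equiv> return borel x"

definition P_ex :: "real measure" where
  "P_ex = measure_of UNIV (sets borel)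
     (\<lambda>A. ennreal (149 / 200) * emeasure (dirac 1) A
        + ennreal (1 / 200) * emeasure (dirac 2) A
        + (\<Sum>k. ennreal (1 / 2 ^ (k + 3)) * emeasure (dirac (real (k + 3))) A))"

text \<open>\<^const>\<open>measure_of\<close> yields the null measure unless the given set function is
  countably additive; the following facts show that this does not happen here.\<close>

lemma sets_P_ex [simp, measurable_cong]: "sets P_ex = sets borel"
proof -
  have "sigma_sets UNIV (sets (borel :: real measure)) = sets borel"
    using sets.sigma_sets_eq[of "borel :: real measure"] by simp
  then show ?thesis unfolding P_ex_def by simp
qed

lemma space_P_ex [simp]: "space P_ex = UNIV"
  using sets_eq_imp_space_eq[OF sets_P_ex] by simp

lemma emeasure_P_ex:
  assumes "A \<in> sets borel"
  shows "emeasure P_ex A =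
     ennreal (149 / 200) * emeasure (dirac 1) A
     + ennreal (1 / 200) * emeasure (dirac 2) A
     + (\<Sum>k. ennreal (1 / 2 ^ (k + 3)) * emeasure (dirac (real (k + 3))) A)"
proof -
  let ?\<mu> = "\<lambda>A. ennreal (149 / 200) * emeasure (dirac 1) A
        + ennreal (1 / 200) * emeasure (dirac 2) A
        + (\<Sum>k. ennreal (1 / 2 ^ (k + 3)) * emeasure (dirac (real (k + 3))) A)"
  have swap: "(\<Sum>k. \<Sum>i. f k i) = (\<Sum>i. \<Sum>k. f k i)" for f :: "nat \<Rightarrow> nat \<Rightarrow> ennreal"
    using nn_integral_suminf[of "\<lambda>i k. f k i" "count_space UNIV"]
    by (simp add: nn_integral_count_space_nat)
  have "countably_additive (sets borel) ?\<mu>"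
  proof (rule countably_additiveI)
    fix B :: "nat \<Rightarrow> real set"
    assume B: "range B \<subseteq> sets borel" "disjoint_family B" "(\<Union>i. B i) \<in> sets borel"
    have d: "emeasure (dirac x) (\<Union>i. B i) = (\<Sum>i. emeasure (dirac x) (B i))" for x
      using B by (intro suminf_emeasure[symmetric]) auto
    have "(\<Sum>k. ennreal (1 / 2 ^ (k + 3)) * (\<Sum>i. emeasure (dirac (real (k + 3))) (B i)))
        = (\<Sum>k. \<Sum>i. ennreal (1 / 2 ^ (k + 3)) * emeasure (dirac (real (k + 3))) (B i))"
      by (simp only: ennreal_suminf_cmult)
    also have "\<dots> = (\<Sum>i. \<Sum>k. ennreal (1 / 2 ^ (k + 3)) * emeasure (dirac (real (k + 3))) (B i))"
      by (rule swap)
    finally show "(\<Sum>i. ?\<mu> (B i)) = ?\<mu> (\<Union>i. B i)"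
      by (simp only: d suminf_add[OF summableI summableI, symmetric] ennreal_suminf_cmult)
  qed
  moreover have "positive (sets borel) ?\<mu>"
    by (simp add: positive_def)
  moreover have "sigma_algebra UNIV (sets (borel :: real measure))"
    using sets.sigma_algebra_axioms[of "borel :: real measure"] by simp
  ultimately show ?thesis
    unfolding P_ex_def using assms by (intro emeasure_measure_of_sigma) auto
qed

lemma prob_space_P_ex: "prob_space P_ex"
proof (rule prob_spaceI)
  have "(\<lambda>k. (1 / 8) * (1 / 2) ^ k :: real) sums ((1 / 8) * (1 / (1 - 1 / 2)))"
    by (intro sums_mult geometric_sums) simp
  then have "(\<lambda>k. 1 / 2 ^ (k + 3) :: real) sums (1 / 4)"
    by (simp add: power_add power_one_over field_simps)
  then have s: "(\<Sum>k. ennreal (1 / 2 ^ (k + 3))) = ennreal (1 / 4)"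
    by (intro suminf_ennreal_eq) auto
  have "emeasure P_ex UNIV
      = ennreal (149 / 200) + ennreal (1 / 200) + (\<Sum>k. ennreal (1 / 2 ^ (k + 3)))"
    by (subst emeasure_P_ex) (simp_all del: ennreal_plus)
  also have "\<dots> = ennreal (149 / 200 + 1 / 200 + 1 / 4)"
    unfolding s by (simp only: ennreal_plus[symmetric])
  finally show "emeasure P_ex (space P_ex) = 1" by simp
qed

end

theory Submission
  imports Defs "HOL-Real_Asymp.Real_Asymp"
begin

text \<open>The points closest to the leftmost mean \<open>a\<close> form an initial segment of the support, and the
  other points only see the remaining means. Beyond \<open>2\<close> the measure is geometric, so cutting off
  an initial segment of length \<open>l\<close> leaves a scaled copy (by \<open>1/2\<^sup>l\<close>) of the same problem with one
  mean less. This recursion gives the optimal errors \<open>4, 4/3, 2/3, 1/3\<close> for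
  \<open>1, 2, 3, 4\<close> means and weights \<open>1, 1/2, 1/4, \<dots>\<close>; for three means a first cell of length one
  and a first cell of length two tie, which is the source of the two optimal sets. At the
  heavy point \<open>1\<close> and the light point \<open>2\<close> only few first cells have to be compared.\<close>

definition dmin :: "real set \<Rightarrow> real \<Rightarrow> real" where
  "dmin \<alpha> x = Min ((\<lambda>a. \<bar>x - a\<bar>\<^sup>2) ` \<alpha>)"

text \<open>The weights are left unnormalised, with total mass 2, so that cutting off
  \<open>l\<close> points rescales the tail by exactly \<open>(1/2)^l\<close>.\<close>

definition geo :: "real \<Rightarrow> real set \<Rightarrow> real" where
  "geo s \<alpha> = (\<Sum>k. (1/2)^k * dmin \<alpha> (s + real k))"

text \<open>Here \<open>t\<close> stands for \<open>s - a\<close>, the offset of the first point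
  \<open>s\<close> of the cell from the mean \<open>a\<close> that serves it.\<close>

definition cell_cost :: "nat \<Rightarrow> real \<Rightarrow> real" where
  "cell_cost l t = (\<Sum>j<l. (1/2)^j * (t + real j)\<^sup>2)"

text \<open>The index 0 carries no mass; including it lets the measure be written as a density on
  all of \<open>nat\<close>.\<close>

definition wt :: "nat \<Rightarrow> real" where
  "wt j = (if j = 0 then 0 else if j = 1 then 149/200 else if j = 2 then 1/200 else (1/2)^j)"

text \<open>The factor 1/8 is the mass at 3, where \<open>geo 3\<close> starts with weight
  1.\<close>

definition err :: "real set \<Rightarrow> real" where
  "err \<alpha> = 149/200 * dmin \<alpha> 1 + 1/200 * dmin \<alpha> 2 + 1/8 * geo 3 \<alpha>"


section \<open>Integration with respect to the discrete measure\<close>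

lemma wt_nonneg [simp]: "0 \<le> wt j"
  by (simp add: wt_def)

lemma suminf_ennreal_split:
  fixes f :: "nat \<Rightarrow> ennreal"
  shows "(\<Sum>j. f j) = f 0 + f 1 + f 2 + (\<Sum>k. f (k + 3))"
proof -
  have "(\<Sum>j. f j) = (\<Sum>k. f (k + 3)) + sum f {..<3}"
    by (rule suminf_offset) (rule summableI)
  then show ?thesis
    by (simp add: numeral_3_eq_3 numeral_2_eq_2 add_ac)
qed

text \<open>As an image of a density on counting measure, \<open>P_ex\<close> turns every integral
  into a series.\<close>

lemma P_ex_eq: "P_ex = distr (density (count_space UNIV) (\<lambda>j. ennreal (wt j))) borel real"
proof (rule measure_eqI)
  fix A assume "A \<in> sets P_ex"
  then have A: "A \<in> sets borel" by simp
  have "emeasure (distr (density (count_space UNIV) (\<lambda>j. ennreal (wt j))) borel real) A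
      = (\<Sum>j. ennreal (wt j) * indicator A (real j))"
    using A by (simp add: emeasure_distr emeasure_density nn_integral_count_space_nat indicator_def)
  also have "\<dots> = emeasure P_ex A"
    using A by (subst suminf_ennreal_split, subst emeasure_P_ex)
      (simp_all add: wt_def power_one_over)
  finally show "emeasure P_ex A
      = emeasure (distr (density (count_space UNIV) (\<lambda>j. ennreal (wt j))) borel real) A"
    by (rule sym)
qed simp

lemma nn_integral_P_ex:
  assumes [measurable]: "f \<in> borel_measurable borel"
  shows "(\<integral>\<^sup>+ x. f x \<partial>P_ex) = (\<Sum>j. ennreal (wt j) * f (real j))"
  unfolding P_ex_eq
  by (simp add: nn_integral_distr nn_integral_density nn_integral_count_space_nat)

lemma measure_P_ex: "measure P_ex {real m} = wt m"
proof -
  have "emeasure P_ex {real m} = (\<Sum>j. ennreal (wt j) * indicator {real m} (real j))"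
    using nn_integral_P_ex[of "indicator {real m}"] by simp
  also have "\<dots> = (\<Sum>j\<in>{m}. ennreal (wt j) * indicator {real m} (real j))"
    by (rule suminf_finite) auto
  finally show ?thesis
    by (simp add: measure_def)
qed


section \<open>The squared distance to a finite set\<close>

lemma dmin_nonneg: "finite \<alpha> \<Longrightarrow> \<alpha> \<noteq> {} \<Longrightarrow> 0 \<le> dmin \<alpha> x"
  by (auto simp: dmin_def)

lemma dmin_le: "finite \<alpha> \<Longrightarrow> a \<in> \<alpha> \<Longrightarrow> dmin \<alpha> x \<le> (x - a)\<^sup>2"
  unfolding dmin_def by (rule Min_le) auto

lemma dmin_antimono: "finite \<alpha> \<Longrightarrow> \<beta> \<subseteq> \<alpha> \<Longrightarrow> \<beta> \<noteq> {} \<Longrightarrow> dmin \<alpha> x \<le> dmin \<beta> x"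
  unfolding dmin_def by (intro Min_antimono) auto

lemma dmin_singleton [simp]: "dmin {a} x = (x - a)\<^sup>2"
  by (simp add: dmin_def)

lemma dmin_insert:
  "finite \<beta> \<Longrightarrow> \<beta> \<noteq> {} \<Longrightarrow> dmin (insert a \<beta>) x = min ((x - a)\<^sup>2) (dmin \<beta> x)"
  by (simp add: dmin_def)

lemma dmin_measurable [measurable]: "finite \<alpha> \<Longrightarrow> \<alpha> \<noteq> {} \<Longrightarrow> dmin \<alpha> \<in> borel_measurable borel"
proof (induction \<alpha> rule: finite_ne_induct)
  case (singleton x)
  then show ?case by (simp add: dmin_def)
next
  case (insert x F)
  then have "dmin (insert x F) = (\<lambda>y. min ((y - x)\<^sup>2) (dmin F y))"
    by (intro ext dmin_insert)
  with insert.IH show ?case by simp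
qed

text \<open>The midpoint of the two smallest means separates the points served by the smallest one
  from the rest. The cell may be empty (\<open>l = 0\<close>), and a point on the midpoint is given
  to \<open>\<beta>\<close>.\<close>

lemma voronoi_split:
  assumes "card \<alpha> = Suc n" "n \<noteq> 0"
  obtains a \<beta> l where "\<alpha> = insert a \<beta>" "card \<beta> = n"
    "\<And>j. j < l \<Longrightarrow> dmin \<alpha> (s + real j) = (s + real j - a)\<^sup>2"
    "\<And>j. l \<le> j \<Longrightarrow> dmin \<alpha> (s + real j) = dmin \<beta> (s + real j)"
proof -
  have fin: "finite \<alpha>" "\<alpha> \<noteq> {}"
    using assms card.infinite by fastforce+
  define a where "a = Min \<alpha>"
  define \<beta> where "\<beta> = \<alpha> - {a}"
  have a: "a \<in> \<alpha>" using fin by (simp add: a_def)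
  have eq: "\<alpha> = insert a \<beta>" using a by (auto simp: \<beta>_def)
  have card: "card \<beta> = n" using assms a fin by (simp add: \<beta>_def)
  have fb: "finite \<beta>" "\<beta> \<noteq> {}" using card assms(2) fin by (simp add: \<beta>_def, fastforce)
  define b where "b = Min \<beta>"
  have b: "b \<in> \<beta>" using fb by (simp add: b_def)
  have ab: "a < b" using b fin by (auto simp: \<beta>_def a_def less_le)
  \<comment> \<open>This counts the points \<open>s + real j\<close> strictly left of the midpoint;
    \<open>nat\<close> yields 0 when there are none.\<close>
  define l where "l = nat \<lceil>(a + b) / 2 - s\<rceil>"
  have lt: "j < l \<longleftrightarrow> 2 * (s + real j) < a + b" for j
    unfolding l_def by (simp add: zless_nat_eq_int_zless less_ceiling_iff field_simps)
  have sq: "(x - c)\<^sup>2 - (x - a)\<^sup>2 = (c - a) * (a + c - 2 * x)" for x c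
    by (simp add: power2_eq_square algebra_simps)
  have "dmin \<alpha> (s + real j) = (s + real j - a)\<^sup>2" if "j < l" for j
  proof -
    have "(s + real j - a)\<^sup>2 \<le> (s + real j - c)\<^sup>2" if "c \<in> \<beta>" for c
    proof -
      have "b \<le> c" using that fb by (simp add: b_def)
      then have "0 \<le> (c - a) * (a + c - 2 * (s + real j))"
        using ab lt[of j] \<open>j < l\<close> by (intro mult_nonneg_nonneg) linarith+
      then show ?thesis using sq[where x = "s + real j" and c = c] by linarith
    qed
    then have "(s + real j - a)\<^sup>2 \<le> dmin \<beta> (s + real j)"
      using fb by (simp add: dmin_def)
    then show ?thesis using fb by (simp add: eq dmin_insert)
  qed
  moreover have "dmin \<alpha> (s + real j) = dmin \<beta> (s + real j)" if "l \<le> j" for j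
  proof -
    have "(s + real j - b)\<^sup>2 \<le> (s + real j - a)\<^sup>2"
    proof -
      have "(b - a) * (a + b - 2 * (s + real j)) \<le> 0"
        using ab lt[of j] that by (intro mult_nonneg_nonpos) linarith+
      then show ?thesis using sq[where x = "s + real j" and c = b] by linarith
    qed
    with dmin_le[OF fb(1) b, of "s + real j"] show ?thesis
      using fb by (simp add: eq dmin_insert)
  qed
  ultimately show thesis using that eq card by blast
qed


section \<open>Geometric weights\<close>

text \<open>The weights have mass 2, mean \<open>s + 1\<close> and variance 2, whence the minimum 4
  and the quadratic excess.\<close>

lemma sums_geo_singleton: "(\<lambda>k. (1/2)^k * (s + real k - a)\<^sup>2) sums (4 + 2 * (s + 1 - a)\<^sup>2)"
proof -
  \<comment> \<open>\<open>F k\<close> is the tail of the series from index \<open>k\<close> on, so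
    its differences are the terms.\<close>
  define F where "F k = (1/2::real)^k * (2 * (s + real k - a)\<^sup>2 + 4 * (s + real k - a) + 6)" for k
  have "F \<longlonglongrightarrow> 0" unfolding F_def by real_asymp
  then have "(\<lambda>k. F k - F (Suc k)) sums (F 0 - 0)" by (rule telescope_sums')
  moreover have "F k - F (Suc k) = (1/2)^k * (s + real k - a)\<^sup>2" for k
    by (simp add: F_def field_simps power2_eq_square)
  moreover have "F 0 - 0 = 4 + 2 * (s + 1 - a)\<^sup>2"
    by (simp add: F_def field_simps power2_eq_square)
  ultimately show ?thesis by simp
qed

lemma geo_singleton: "geo s {a} = 4 + 2 * (s + 1 - a)\<^sup>2"
  using sums_geo_singleton[of s a] by (simp add: geo_def sums_iff)

lemma geo_summable:
  assumes "finite \<alpha>" "\<alpha> \<noteq> {}"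
  shows "summable (\<lambda>k. (1/2)^k * dmin \<alpha> (s + real k))"
proof -
  obtain a where a: "a \<in> \<alpha>" using assms by blast
  show ?thesis
  proof (rule summable_comparison_test')
    show "summable (\<lambda>k. (1/2)^k * (s + real k - a)\<^sup>2)"
      using sums_geo_singleton by (rule sums_summable)
    show "norm ((1/2)^k * dmin \<alpha> (s + real k)) \<le> (1/2)^k * (s + real k - a)\<^sup>2" if "k \<ge> 0" for k
      using dmin_le[OF assms(1) a] dmin_nonneg[OF assms] by (simp add: abs_mult)
  qed
qed

lemma geo_nonneg: "finite \<alpha> \<Longrightarrow> \<alpha> \<noteq> {} \<Longrightarrow> 0 \<le> geo s \<alpha>"
  unfolding geo_def by (intro suminf_nonneg geo_summable) (auto simp: dmin_nonneg)

lemma geo_shift: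
  assumes "finite \<alpha>" "\<alpha> \<noteq> {}"
  shows "geo s \<alpha> = (\<Sum>j<l. (1/2)^j * dmin \<alpha> (s + real j)) + (1/2)^l * geo (s + real l) \<alpha>"
proof -
  have "geo s \<alpha> = (\<Sum>k. (1/2)^(k + l) * dmin \<alpha> (s + real (k + l))) + (\<Sum>j<l. (1/2)^j * dmin \<alpha> (s + real j))"
    unfolding geo_def by (rule suminf_split_initial_segment) (rule geo_summable[OF assms])
  also have "(\<Sum>k. (1/2)^(k + l) * dmin \<alpha> (s + real (k + l)))
      = (\<Sum>k. (1/2)^l * ((1/2)^k * dmin \<alpha> (s + real l + real k)))"
    by (simp add: power_add algebra_simps)
  also have "\<dots> = (1/2)^l * geo (s + real l) \<alpha>"
    unfolding geo_def by (rule suminf_mult) (rule geo_summable[OF assms])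
  finally show ?thesis by simp
qed

text \<open>This is the recursion step. Being an equation, it transmits both the lower bound and the
  equality case from \<open>\<beta>\<close> to \<open>\<alpha>\<close>.\<close>

lemma geo_split:
  assumes "card \<alpha> = Suc n" "n \<noteq> 0"
  obtains a \<beta> l where "\<alpha> = insert a \<beta>" "card \<beta> = n"
    "geo s \<alpha> = cell_cost l (s - a) + (1/2)^l * geo (s + real l) \<beta>"
proof -
  obtain a \<beta> l where *: "\<alpha> = insert a \<beta>" "card \<beta> = n"
    "\<And>j. j < l \<Longrightarrow> dmin \<alpha> (s + real j) = (s + real j - a)\<^sup>2"
    "\<And>j. l \<le> j \<Longrightarrow> dmin \<alpha> (s + real j) = dmin \<beta> (s + real j)"
    using voronoi_split[OF assms] by metis
  have fin: "finite \<alpha>" "\<alpha> \<noteq> {}"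
    using assms card.infinite by fastforce+
  have "geo (s + real l) \<alpha> = geo (s + real l) \<beta>"
    unfolding geo_def using *(4)[of "l + k" for k] by (simp add: add.assoc)
  moreover have "(\<Sum>j<l. (1/2)^j * dmin \<alpha> (s + real j)) = cell_cost l (s - a)"
    unfolding cell_cost_def by (intro sum.cong) (auto simp: *(3) algebra_simps)
  ultimately show thesis
    using that *(1,2) geo_shift[OF fin, of s l] by simp
qed

section \<open>Minimal costs of cells by completing the square\<close>

lemma cell_cost_mono: "k \<le> l \<Longrightarrow> cell_cost k t \<le> cell_cost l t"
  unfolding cell_cost_def by (rule sum_mono2) auto

lemma cell_cost_0 [simp]: "cell_cost 0 t = 0"
  by (simp add: cell_cost_def)

lemma cell_cost_1 [simp]: "cell_cost (Suc 0) t = t\<^sup>2"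
  by (simp add: cell_cost_def)

text \<open>The square vanishes when \<open>a\<close> is the weighted mean of the cell, here
  \<open>s + 1/3\<close>; the constant is then the minimal cost.\<close>

lemma cell_cost_2: "cell_cost 2 t = 3/2 * (t + 1/3)\<^sup>2 + 1/3"
  by (simp add: cell_cost_def numeral_2_eq_2 power2_eq_square field_simps)

lemma cell_cost_3: "cell_cost 3 t = 7/4 * (t + 4/7)\<^sup>2 + 13/14"
  by (simp add: cell_cost_def eval_nat_numeral field_simps)

lemma cell_cost_4: "cell_cost 4 t = 15/8 * (t + 11/15)\<^sup>2 + 97/60"
  by (simp add: cell_cost_def eval_nat_numeral field_simps)

text \<open>Monotonicity in the length disposes of all long cells at once and leaves finitely many
  lengths to compare.\<close>

lemma cell_cost_ge_2: "2 \<le> l \<Longrightarrow> 1/3 \<le> cell_cost l t"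
  using cell_cost_mono[of 2 l t] zero_le_power2[of "t + 1/3"] unfolding cell_cost_2 by linarith

lemma cell_cost_ge_3: "3 \<le> l \<Longrightarrow> 13/14 \<le> cell_cost l t"
  using cell_cost_mono[of 3 l t] zero_le_power2[of "t + 4/7"] unfolding cell_cost_3 by linarith

lemma cell_cost_ge_4: "4 \<le> l \<Longrightarrow> 97/60 \<le> cell_cost l t"
  using cell_cost_mono[of 4 l t] zero_le_power2[of "t + 11/15"] unfolding cell_cost_4 by linarith

section \<open>Optimal geometric errors for one to four means\<close>

lemma geo_card_1: "card \<alpha> = 1 \<Longrightarrow> 4 \<le> geo s \<alpha> \<and> (geo s \<alpha> = 4 \<longrightarrow> \<alpha> = {s + 1})"
  by (auto simp: card_1_singleton_iff geo_singleton)

text \<open>First cells of length 0, 1, 2, 3 give at least 4, 2, 4/3 and 13/14 + 1/2, and longer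
  ones at least 97/60, so only length 2 attains the bound.\<close>

lemma geo_card_2:
  assumes "card \<alpha> = 2"
  shows "4/3 \<le> geo s \<alpha> \<and> (geo s \<alpha> = 4/3 \<longrightarrow> \<alpha> = {s + 1/3, s + 3})"
proof -
  have "card \<alpha> = Suc 1" using assms by simp
  then obtain a \<beta> l where *: "\<alpha> = insert a \<beta>" "card \<beta> = 1"
    "geo s \<alpha> = cell_cost l (s - a) + (1/2)^l * geo (s + real l) \<beta>"
    by (rule geo_split[where s = s]) auto
  note T = geo_card_1[OF *(2)]
  consider "l = 0" | "l = 1" | "l = 2" | "l = 3" | "4 \<le> l" by linarith
  then show ?thesis
  proof cases
    case 1
    with * T[of s] show ?thesis by simp
  next
    case 2
    then have "geo s \<alpha> = (s - a)\<^sup>2 + 1/2 * geo (s + 1) \<beta>" using * by simp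
    with T[of "s + 1"] zero_le_power2[of "s - a"] show ?thesis by linarith
  next
    case 3
    have v: "geo s \<alpha> = 3/2 * (s - a + 1/3)\<^sup>2 + 1/3 + 1/4 * geo (s + 2) \<beta>"
      using * 3 by (simp add: cell_cost_2 power2_eq_square)
    have le: "4/3 \<le> geo s \<alpha>" using v T[of "s + 2"] zero_le_power2[of "s - a + 1/3"] by linarith
    moreover have "\<alpha> = {s + 1/3, s + 3}" if "geo s \<alpha> = 4/3"
    proof -
      have "(s - a + 1/3)\<^sup>2 = 0" "geo (s + 2) \<beta> = 4"
        using that v T[of "s + 2"] zero_le_power2[of "s - a + 1/3"] by linarith+
      then have "a = s + 1/3" "\<beta> = {s + 3}"
        using T[of "s + 2"] by (simp_all add: add.assoc)
      then show ?thesis using *(1) by simp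
    qed
    ultimately show ?thesis by blast
  next
    case 4
    \<comment> \<open>The cell alone costs only 13/14 < 4/3, so the tail, at least 4/8, has to be
      kept.\<close>
    have "geo s \<alpha> = cell_cost 3 (s - a) + 1/8 * geo (s + 3) \<beta>"
      using * 4 by (simp add: power3_eq_cube)
    with cell_cost_ge_3[of 3 "s - a"] T[of "s + 3"] show ?thesis by simp
  next
    case 5
    have "0 \<le> (1/2)^l * geo (s + real l) \<beta>" using T[of "s + real l"] by simp
    with cell_cost_ge_4[OF 5, of "s - a"] *(3) show ?thesis by simp
  qed
qed

text \<open>Length 1 gives (1/2)(4/3) and length 2 gives 1/3 + (1/4)(4/3), both 2/3: this is the
  tie. Length 0 gives 4/3, and lengths from 3 on give at least 13/14.\<close>

lemma geo_card_3:
  assumes "card \<alpha> = 3"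
  shows "2/3 \<le> geo s \<alpha> \<and> (geo s \<alpha> = 2/3 \<longrightarrow>
    \<alpha> = {s, s + 4/3, s + 4} \<or> \<alpha> = {s + 1/3, s + 7/3, s + 5})"
proof -
  have "card \<alpha> = Suc 2" using assms by simp
  then obtain a \<beta> l where *: "\<alpha> = insert a \<beta>" "card \<beta> = 2"
    "geo s \<alpha> = cell_cost l (s - a) + (1/2)^l * geo (s + real l) \<beta>"
    by (rule geo_split[where s = s]) auto
  note T = geo_card_2[OF *(2)]
  consider "l = 0" | "l = 1" | "l = 2" | "3 \<le> l" by linarith
  then show ?thesis
  proof cases
    case 1
    with * T[of s] show ?thesis by simp
  next
    case 2
    have v: "geo s \<alpha> = (s - a)\<^sup>2 + 1/2 * geo (s + 1) \<beta>"
      using * 2 by simp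
    have le: "2/3 \<le> geo s \<alpha>" using v T[of "s + 1"] zero_le_power2[of "s - a"] by linarith
    moreover have "\<alpha> = {s, s + 4/3, s + 4}" if "geo s \<alpha> = 2/3"
    proof -
      have "(s - a)\<^sup>2 = 0" "geo (s + 1) \<beta> = 4/3"
        using that v T[of "s + 1"] zero_le_power2[of "s - a"] by linarith+
      then show ?thesis using T[of "s + 1"] *(1) by (simp add: add.assoc)
    qed
    ultimately show ?thesis by blast
  next
    case 3
    have v: "geo s \<alpha> = 3/2 * (s - a + 1/3)\<^sup>2 + 1/3 + 1/4 * geo (s + 2) \<beta>"
      using * 3 by (simp add: cell_cost_2 power2_eq_square)
    have le: "2/3 \<le> geo s \<alpha>" using v T[of "s + 2"] zero_le_power2[of "s - a + 1/3"] by linarith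
    moreover have "\<alpha> = {s + 1/3, s + 7/3, s + 5}" if "geo s \<alpha> = 2/3"
    proof -
      have "(s - a + 1/3)\<^sup>2 = 0" "geo (s + 2) \<beta> = 4/3"
        using that v T[of "s + 2"] zero_le_power2[of "s - a + 1/3"] by linarith+
      then have "a = s + 1/3" "\<beta> = {s + 7/3, s + 5}"
        using T[of "s + 2"] by (simp_all add: add.assoc)
      then show ?thesis using *(1) by simp
    qed
    ultimately show ?thesis by blast
  next
    case 4
    have "0 \<le> (1/2)^l * geo (s + real l) \<beta>" using T[of "s + real l"] by simp
    with cell_cost_ge_3[OF 4, of "s - a"] *(3) show ?thesis by simp
  qed
qed

text \<open>Length 1 gives (1/2)(2/3) = 1/3; from length 2 on the first cell alone already costs
  1/3.\<close>

lemma geo_card_4: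
  assumes "card \<alpha> = 4"
  shows "1/3 \<le> geo s \<alpha>"
proof -
  have "card \<alpha> = Suc 3" using assms by simp
  then obtain a \<beta> l where *: "\<alpha> = insert a \<beta>" "card \<beta> = 3"
    "geo s \<alpha> = cell_cost l (s - a) + (1/2)^l * geo (s + real l) \<beta>"
    by (rule geo_split[where s = s]) auto
  note T = geo_card_3[OF *(2)]
  consider "l = 0" | "l = 1" | "2 \<le> l" by linarith
  then show ?thesis
  proof cases
    case 1
    with * T[of s] show ?thesis by simp
  next
    case 2
    then have "geo s \<alpha> = (s - a)\<^sup>2 + 1/2 * geo (s + 1) \<beta>" using * by simp
    with T[of "s + 1"] zero_le_power2[of "s - a"] show ?thesis by linarith
  next
    case 3
    have "0 \<le> (1/2)^l * geo (s + real l) \<beta>" using T[of "s + real l"] by simp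
    with cell_cost_ge_2[OF 3, of "s - a"] *(3) show ?thesis by simp
  qed
qed


section \<open>The distortion error\<close>

lemma distortion_P_ex:
  assumes "finite \<alpha>" "\<alpha> \<noteq> {}"
  shows "distortion P_ex \<alpha> = ennreal (err \<alpha>)"
proof -
  have meas: "(\<lambda>x. ennreal (dmin \<alpha> x)) \<in> borel_measurable borel"
    using assms by measurable
  note [simp] = dmin_nonneg[OF assms]
  have "distortion P_ex \<alpha> = (\<Sum>j. ennreal (wt j) * ennreal (dmin \<alpha> (real j)))"
    unfolding distortion_def using nn_integral_P_ex[OF meas] by (simp add: dmin_def)
  also have "\<dots> = ennreal (149/200 * dmin \<alpha> 1) + ennreal (1/200 * dmin \<alpha> 2)
      + (\<Sum>k. ennreal ((1/2)^(k + 3) * dmin \<alpha> (real (k + 3))))"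
    by (subst suminf_ennreal_split) (simp add: wt_def ennreal_mult del: times_divide_eq_left)
  also have "(\<Sum>k. ennreal ((1/2)^(k + 3) * dmin \<alpha> (real (k + 3)))) = ennreal (1/8 * geo 3 \<alpha>)"
  proof (rule suminf_ennreal_eq)
    have "(\<lambda>k. 1/8 * ((1/2)^k * dmin \<alpha> (3 + real k))) sums (1/8 * geo 3 \<alpha>)"
      unfolding geo_def by (intro sums_mult summable_sums geo_summable assms)
    then show "(\<lambda>k. (1/2)^(k + 3) * dmin \<alpha> (real (k + 3))) sums (1/8 * geo 3 \<alpha>)"
      by (simp add: power_add power3_eq_cube add.commute)
  qed simp
  finally show ?thesis
    using geo_nonneg[OF assms, of 3] by (simp add: err_def ennreal_plus[symmetric] del: ennreal_plus)
qed

lemma finite_if_card: "1 \<le> card \<alpha> \<Longrightarrow> finite \<alpha> \<and> \<alpha> \<noteq> {}"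
  using card.infinite by fastforce

section \<open>Lower bounds for the full measure\<close>

text \<open>Serving the heavy point 1 and the point 3 by one mean is too expensive: the best choice
  is their weighted mean 224/174. The threshold 1/12 is (1/8)(2/3), the bound when three means serve
  the points from 3 on.\<close>

lemma err_ge_first_cell_3:
  assumes fin: "finite \<alpha>" "\<alpha> \<noteq> {}"
    and "dmin \<alpha> 1 = (1 - a)\<^sup>2" "dmin \<alpha> 3 = (3 - a)\<^sup>2"
  shows "1/12 \<le> err \<alpha>"
proof -
  have "geo 3 \<alpha> \<ge> (3 - a)\<^sup>2"
    using geo_shift[OF fin, of 3 1] geo_nonneg[OF fin, of "3 + real 1"] assms by simp
  moreover have "1/12 \<le> 149/200 * (1 - a)\<^sup>2 + 1/8 * (3 - a)\<^sup>2"
  proof -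
    have "149/200 * (1 - a)\<^sup>2 + 1/8 * (3 - a)\<^sup>2
        = 174/200 * (a - 224/174)\<^sup>2 + (374/200 - 224^2/(174*200))"
      by (simp add: power2_eq_square field_simps)
    moreover have "(1/12::real) \<le> 374/200 - 224^2/(174*200)" by simp
    ultimately show ?thesis using zero_le_power2[of "a - 224/174"] by linarith
  qed
  ultimately show ?thesis
    using assms dmin_nonneg[OF fin, of 2] unfolding err_def by linarith
qed

lemma geo_cong: "(\<And>k. dmin \<alpha> (s + real k) = dmin \<beta> (s + real k)) \<Longrightarrow> geo s \<alpha> = geo s \<beta>"
  by (simp add: geo_def)

lemma err_ge_geo: "finite \<alpha> \<Longrightarrow> \<alpha> \<noteq> {} \<Longrightarrow> 1/8 * geo 3 \<alpha> \<le> err \<alpha>"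
  using dmin_nonneg[of \<alpha> 1] dmin_nonneg[of \<alpha> 2] by (simp add: err_def)

text \<open>With four means, either the first one serves at most the points 1 and 2, leaving three
  means for the rest, or it serves both 1 and 3. Since 1/12 > 29/624, fewer than five means cannot
  compete.\<close>

lemma err_card_le_4:
  assumes "1 \<le> card \<alpha>" "card \<alpha> \<le> 4"
  shows "1/12 \<le> err \<alpha>"
proof -
  have fin: "finite \<alpha>" "\<alpha> \<noteq> {}" using finite_if_card[OF assms(1)] by auto
  note ge = err_ge_geo[OF fin]
  consider "card \<alpha> = 1" | "card \<alpha> = 2" | "card \<alpha> = 3" | "card \<alpha> = Suc 3"
    using assms by linarith
  then show ?thesis
  proof cases
    case 1
    with ge geo_card_1[of \<alpha> 3] show ?thesis by simp
  next
    case 2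
    with ge geo_card_2[of \<alpha> 3] show ?thesis by simp
  next
    case 3
    with ge geo_card_3[of \<alpha> 3] show ?thesis by simp
  next
    case 4
    then obtain a \<beta> l where *: "\<alpha> = insert a \<beta>" "card \<beta> = 3"
      "\<And>j. j < l \<Longrightarrow> dmin \<alpha> (1 + real j) = (1 + real j - a)\<^sup>2"
      "\<And>j. l \<le> j \<Longrightarrow> dmin \<alpha> (1 + real j) = dmin \<beta> (1 + real j)"
      by (rule voronoi_split[where s = 1]) auto
    show ?thesis
    proof (cases "l \<le> 2")
      case True
      then have "geo 3 \<alpha> = geo 3 \<beta>"
        using *(4)[of "2 + k" for k] by (intro geo_cong) (simp add: add.assoc[symmetric])
      with ge geo_card_3[OF *(2), of 3] show ?thesis by simp
    next
      case False
      then show ?thesis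
        using *(3)[of 0] *(3)[of 2] by (intro err_ge_first_cell_3[OF fin, of a]) auto
    qed
  qed
qed

text \<open>Only the cells {1} and {2, 3} survive the comparison; three means then remain for the
  points from 4 on, and both optimal triples of \<open>geo_card_3\<close> occur. The value is 1/208
  + (1/16)(2/3) = 29/624.\<close>

lemma err_card_5:
  assumes "card \<alpha> = 5"
  shows "29/624 \<le> err \<alpha> \<and> (err \<alpha> = 29/624 \<longrightarrow>
    \<alpha> = {1, 77/26, 4, 16/3, 8} \<or> \<alpha> = {1, 77/26, 13/3, 19/3, 9})"
proof -
  have fin: "finite \<alpha>" "\<alpha> \<noteq> {}" using finite_if_card[of \<alpha>] assms by auto
  note ge = err_ge_geo[OF fin]
  have "card \<alpha> = Suc 4" using assms by simp
  then obtain a \<beta> l where *: "\<alpha> = insert a \<beta>" "card \<beta> = 4"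
    "\<And>j. j < l \<Longrightarrow> dmin \<alpha> (1 + real j) = (1 + real j - a)\<^sup>2"
    "\<And>j. l \<le> j \<Longrightarrow> dmin \<alpha> (1 + real j) = dmin \<beta> (1 + real j)"
    by (rule voronoi_split[where s = 1]) auto
  have finb: "finite \<beta>" "\<beta> \<noteq> {}" using finite_if_card[of \<beta>] *(2) by auto
  have g3: "geo 3 \<alpha> = geo 3 \<beta>" if "l \<le> 2"
    using *(4)[of "2 + k" for k] that by (intro geo_cong) (simp add: add.assoc[symmetric])
  consider "l = 0" | "l = 1" | "l = 2" | "3 \<le> l" by linarith
  then show ?thesis
  proof cases
    case 1
    then have "err \<alpha> = err \<beta>"
      using *(4)[of 0] *(4)[of 1] g3 by (simp add: err_def)
    with err_card_le_4[of \<beta>] *(2) show ?thesis by simp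
  next
    case 3
    have "err \<alpha> = 149/200 * (1 - a)\<^sup>2 + 1/200 * (2 - a)\<^sup>2 + 1/8 * geo 3 \<beta>"
      using *(3)[of 0] *(3)[of 1] g3 3 by (simp add: err_def)
    \<comment> \<open>Joining the light point 2 to the cell of 1 loses narrowly: 149/30000 + 1/24
      slightly exceeds 29/624.\<close>
    moreover have "149/200 * (1 - a)\<^sup>2 + 1/200 * (2 - a)\<^sup>2 = 3/4 * (a - 151/150)\<^sup>2 + 149/30000"
      by (simp add: power2_eq_square field_simps)
    ultimately show ?thesis
      using geo_card_4[OF *(2), of 3] zero_le_power2[of "a - 151/150"] by linarith
  next
    case 4
    then have "1/12 \<le> err \<alpha>"
      using *(3)[of 0] *(3)[of 2] by (intro err_ge_first_cell_3[OF fin, of a]) auto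
    then show ?thesis by simp
  next
    case 2
    have d1: "dmin \<alpha> 1 = (1 - a)\<^sup>2" and d2: "dmin \<alpha> 2 = dmin \<beta> 2"
      using *(3)[of 0] *(4)[of 1] 2 by auto
    have V: "err \<alpha> = 149/200 * (1 - a)\<^sup>2 + 1/200 * dmin \<beta> 2 + 1/8 * geo 3 \<beta>"
      using d1 d2 g3 2 by (simp add: err_def)
    have "card \<beta> = Suc 3" using * by simp
    then obtain b \<gamma> m where **: "\<beta> = insert b \<gamma>" "card \<gamma> = 3"
      "\<And>j. j < m \<Longrightarrow> dmin \<beta> (2 + real j) = (2 + real j - b)\<^sup>2"
      "\<And>j. m \<le> j \<Longrightarrow> dmin \<beta> (2 + real j) = dmin \<gamma> (2 + real j)"
      by (rule voronoi_split[where s = 2]) auto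
    consider "m \<le> 1" | "m = 2" | "3 \<le> m" by linarith
    then show ?thesis
    proof cases
      \<comment> \<open>If \<open>b\<close> serves at most the point 2, only the three means in
        \<open>\<gamma>\<close> are left from 3 on, giving 1/12 again.\<close>
      case 1
      then have "geo 3 \<beta> = geo 3 \<gamma>"
        using **(4)[of "1 + k" for k] by (intro geo_cong) (simp add: add.assoc[symmetric])
      with ge g3 2 geo_card_3[OF **(2), of 3] show ?thesis by simp
    next
      case 2
      have "geo 4 \<beta> = geo 4 \<gamma>"
        using **(4)[of "2 + k" for k] 2 by (intro geo_cong) (simp add: add.assoc[symmetric])
      moreover have "geo 3 \<beta> = (3 - b)\<^sup>2 + 1/2 * geo 4 \<beta>"
        using geo_shift[OF finb, of 3 1] **(3)[of 1] 2 by simp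
      moreover have "dmin \<beta> 2 = (2 - b)\<^sup>2" using **(3)[of 0] 2 by simp
      \<comment> \<open>The points 2 and 3 have weighted mean 77/26 and minimal joint cost
        1/208.\<close>
      moreover have "1/200 * (2 - b)\<^sup>2 + 1/8 * (3 - b)\<^sup>2 = 13/100 * (b - 77/26)\<^sup>2 + 1/208"
        by (simp add: power2_eq_square field_simps)
      ultimately have V': "err \<alpha> = 149/200 * (1 - a)\<^sup>2 + 13/100 * (b - 77/26)\<^sup>2 + 1/208
          + 1/16 * geo 4 \<gamma>"
        using V by (simp add: algebra_simps)
      note T = geo_card_3[OF **(2), of 4] zero_le_power2[of "1 - a"] zero_le_power2[of "b - 77/26"]
      have "29/624 \<le> err \<alpha>" using V' T by linarith
      moreover have "\<alpha> = {1, 77/26, 4, 16/3, 8} \<or> \<alpha> = {1, 77/26, 13/3, 19/3, 9}"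
        if "err \<alpha> = 29/624"
      proof -
        \<comment> \<open>The error is 29/624 plus three nonnegative excesses, so each of them
          vanishes.\<close>
        have "(1 - a)\<^sup>2 = 0" "(b - 77/26)\<^sup>2 = 0" "geo 4 \<gamma> = 2/3"
          using that V' T by linarith+
        then show ?thesis using T(1) *(1) **(1) by auto
      qed
      ultimately show ?thesis by blast
    next
      case 3
      have "geo 3 \<beta> \<ge> (3 - b)\<^sup>2 + 1/2 * (4 - b)\<^sup>2"
        using geo_shift[OF finb, of 3 2] **(3)[of 1] **(3)[of 2] 3 geo_nonneg[OF finb, of "3 + real 2"]
        by (simp add: numeral_2_eq_2)
      moreover have "dmin \<beta> 2 = (2 - b)\<^sup>2" using **(3)[of 0] 3 by simp
      \<comment> \<open>Even without the points beyond 4, a cell containing 2, 3 and 4, with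
        weighted mean 254/77, costs too much.\<close>
      moreover have "1/200 * (2 - b)\<^sup>2 + 1/8 * ((3 - b)\<^sup>2 + 1/2 * (4 - b)\<^sup>2)
          = 77/400 * (b - 254/77)\<^sup>2 + (858/400 - 64516/30800)"
        by (simp add: power2_eq_square field_simps)
      moreover have "29/624 < (858/400 - 64516/30800 :: real)" by simp
      ultimately have "29/624 < 1/200 * dmin \<beta> 2 + 1/8 * geo 3 \<beta>"
        using zero_le_power2[of "b - 254/77"] by argo
      then have "29/624 < err \<alpha>"
        using V zero_le_power2[of "1 - a"] by linarith
      then show ?thesis by simp
    qed
  qed
qed

section \<open>Upper bounds for the two candidates\<close>

text \<open>Any assignment of points to means bounds the error from above, so no nearest points need
  to be determined. Taking \<open>\<beta>\<close> equal to \<open>\<alpha>\<close> allows iteration;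
  a singleton \<open>\<beta>\<close> ends it.\<close>

lemma geo_le:
  assumes "finite \<alpha>" "a \<in> \<alpha>" "\<beta> \<subseteq> \<alpha>" "\<beta> \<noteq> {}"
  shows "geo s \<alpha> \<le> cell_cost l (s - a) + (1/2)^l * geo (s + real l) \<beta>"
proof -
  have ne: "\<alpha> \<noteq> {}" and fb: "finite \<beta>" using assms finite_subset by auto
  have "geo (s + real l) \<alpha> \<le> geo (s + real l) \<beta>"
    unfolding geo_def using assms ne fb
    by (intro suminf_le geo_summable mult_left_mono dmin_antimono) auto
  moreover have "(\<Sum>j<l. (1/2)^j * dmin \<alpha> (s + real j)) \<le> cell_cost l (s - a)"
    unfolding cell_cost_def using dmin_le[OF assms(1,2)]
    by (intro sum_mono mult_left_mono) (simp_all add: algebra_simps)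
  ultimately show ?thesis
    using geo_shift[OF assms(1) ne, of s l] by (smt (verit) mult_left_mono zero_le_power zero_le_divide_1_iff)
qed

text \<open>The assignment uses the cells {1}, {2, 3}, {4}, {5, 6} and the points from 7 on.\<close>

lemma err_set_1: "err {1, 77/26, 4, 16/3, 8} \<le> 29/624"
proof -
  let ?S = "{1, 77/26, 4, 16/3, 8} :: real set"
  have "geo 5 ?S \<le> cell_cost 2 (5 - 16/3) + (1/2)^2 * geo (5 + real 2) {8}"
    by (rule geo_le) auto
  then have "geo 5 ?S \<le> 4/3" by (simp add: geo_singleton cell_cost_2 power2_eq_square)
  moreover have "geo 4 ?S \<le> cell_cost 1 (4 - 4) + (1/2)^1 * geo (4 + real 1) ?S"
    by (rule geo_le) auto
  moreover have "geo 3 ?S \<le> cell_cost 1 (3 - 77/26) + (1/2)^1 * geo (3 + real 1) ?S"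
    by (rule geo_le) auto
  moreover have "dmin ?S 1 \<le> (1 - 1)\<^sup>2" "dmin ?S 2 \<le> (2 - 77/26)\<^sup>2"
    by (intro dmin_le; simp)+
  ultimately show ?thesis unfolding err_def by (simp add: power2_eq_square)
qed

text \<open>The assignment uses the cells {1}, {2, 3}, {4, 5}, {6, 7} and the points from 8
  on.\<close>

lemma err_set_2: "err {1, 77/26, 13/3, 19/3, 9} \<le> 29/624"
proof -
  let ?S = "{1, 77/26, 13/3, 19/3, 9} :: real set"
  have "geo 6 ?S \<le> cell_cost 2 (6 - 19/3) + (1/2)^2 * geo (6 + real 2) {9}"
    by (rule geo_le) auto
  then have "geo 6 ?S \<le> 4/3" by (simp add: geo_singleton cell_cost_2 power2_eq_square)
  moreover have "geo 4 ?S \<le> cell_cost 2 (4 - 13/3) + (1/2)^2 * geo (4 + real 2) ?S"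
    by (rule geo_le) auto
  moreover have "geo 3 ?S \<le> cell_cost 1 (3 - 77/26) + (1/2)^1 * geo (3 + real 1) ?S"
    by (rule geo_le) auto
  moreover have "dmin ?S 1 \<le> (1 - 1)\<^sup>2" "dmin ?S 2 \<le> (2 - 77/26)\<^sup>2"
    by (intro dmin_le; simp)+
  ultimately show ?thesis unfolding err_def by (simp add: power2_eq_square cell_cost_2)
qed


section \<open>The conditional means\<close>

lemma Av_2_3: "Av P_ex 2 3 = 77/26"
proof -
  have "{2..3::nat} = {2, 3}" by auto
  then show ?thesis by (simp add: Av_def measure_P_ex wt_def power3_eq_cube del: of_nat_numeral)
qed

text \<open>Consecutive weights are in the ratio 2 : 1, which puts the mean a third of the way to
  the right.\<close>

lemma Av_Suc:
  assumes "3 \<le> i"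
  shows "Av P_ex i (Suc i) = real i + 1/3"
proof -
  have "{i..Suc i} = {i, Suc i}" by auto
  with assms show ?thesis
    by (simp add: Av_def measure_P_ex wt_def field_simps)
qed

lemma Av_inf_P_ex:
  assumes "3 \<le> i"
  shows "Av_inf P_ex i = real i + 1"
proof -
  \<comment> \<open>Again the tail of the series to be summed, now for the terms
    \<open>n / 2^n\<close> with \<open>n \<ge> i + k\<close>.\<close>
  define F where "F k = (1/2::real)^(i + k) * (2 * real (i + k) + 2)" for k
  have "F \<longlonglongrightarrow> 0" unfolding F_def by real_asymp
  then have "(\<lambda>k. F k - F (Suc k)) sums (F 0 - 0)" by (rule telescope_sums')
  moreover have "F k - F (Suc k) = (1/2)^(i + k) * real (i + k)" for k
    by (simp add: F_def field_simps)
  ultimately have "(\<lambda>k. measure P_ex {real (i + k)} * real (i + k)) sums F 0"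
    using assms unfolding measure_P_ex by (simp add: wt_def)
  moreover have "(\<lambda>k. measure P_ex {real (i + k)}) sums ((1/2)^i * 2)"
    using assms sums_mult[OF geometric_sums[of "1/2::real"], of "(1/2)^i"] unfolding measure_P_ex
    by (simp add: wt_def power_add)
  ultimately have "Av_inf P_ex i = F 0 / ((1/2)^i * 2)"
    by (simp only: Av_inf_def sums_iff)
  also have "\<dots> = (2 * real i + 2) / 2"
    by (simp add: F_def)
  finally show ?thesis by simp
qed

theorem proposition5p1:
  shows "(\<forall>\<alpha>. optimal_means P_ex 5 \<alpha> \<longleftrightarrow>
            \<alpha> = {1, Av P_ex 2 3, 4, Av P_ex 5 6, Av_inf P_ex 7} \<or>
            \<alpha> = {1, Av P_ex 2 3, Av P_ex 4 5, Av P_ex 6 7, Av_inf P_ex 8})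
       \<and> quantization_error P_ex 5 = ennreal (29 / 624)"
proof -
  have means: "Av P_ex 4 5 = 13/3" "Av P_ex 5 6 = 16/3" "Av P_ex 6 7 = 19/3"
    "Av_inf P_ex 7 = 8" "Av_inf P_ex 8 = 9"
    using Av_Suc[of 4] Av_Suc[of 5] Av_Suc[of 6] Av_inf_P_ex[of 7] Av_inf_P_ex[of 8] by simp_all
  let ?S1 = "{1, 77/26, 4, 16/3, 8} :: real set"
  let ?S2 = "{1, 77/26, 13/3, 19/3, 9} :: real set"
  have lower: "29/624 \<le> err \<alpha> \<and> (err \<alpha> = 29/624 \<longrightarrow> \<alpha> = ?S1 \<or> \<alpha> = ?S2)"
    if "1 \<le> card \<alpha>" "card \<alpha> \<le> 5" for \<alpha>
  proof (cases "card \<alpha> = 5")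
    case False
    with that err_card_le_4[of \<alpha>] show ?thesis by simp
  qed (rule err_card_5)
  have dist: "distortion P_ex \<alpha> = ennreal (err \<alpha>)" if "1 \<le> card \<alpha>" for \<alpha>
    using finite_if_card[OF that] by (simp add: distortion_P_ex)
  have card: "card ?S1 = 5" "card ?S2 = 5" by simp_all
  have val: "err ?S1 = 29/624" "err ?S2 = 29/624"
    using err_set_1 err_set_2 lower[of ?S1] lower[of ?S2] card by linarith+
  have Q: "quantization_error P_ex 5 = ennreal (29/624)"
    unfolding quantization_error_def
  proof (rule antisym)
    have "(INF \<alpha> \<in> {\<alpha>. 1 \<le> card \<alpha> \<and> card \<alpha> \<le> 5}. distortion P_ex \<alpha>) \<le> distortion P_ex ?S1"
      by (rule INF_lower) (simp add: card)
    also have "\<dots> = ennreal (29/624)"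
      using val(1) card(1) by (simp only: dist)
    finally show "(INF \<alpha> \<in> {\<alpha>. 1 \<le> card \<alpha> \<and> card \<alpha> \<le> 5}. distortion P_ex \<alpha>) \<le> ennreal (29/624)" .
    show "ennreal (29/624) \<le> (INF \<alpha> \<in> {\<alpha>. 1 \<le> card \<alpha> \<and> card \<alpha> \<le> 5}. distortion P_ex \<alpha>)"
      using lower by (intro INF_greatest) (auto simp: dist intro!: ennreal_leI)
  qed
  have "optimal_means P_ex 5 \<alpha> \<longleftrightarrow> \<alpha> = ?S1 \<or> \<alpha> = ?S2" for \<alpha>
  proof
    assume "optimal_means P_ex 5 \<alpha>"
    then have c: "1 \<le> card \<alpha>" "card \<alpha> \<le> 5" and "ennreal (err \<alpha>) = ennreal (29/624)"
      by (auto simp: optimal_means_def Q dist)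
    \<comment> \<open>\<open>ennreal\<close> identifies all negative reals with 0, so injectivity
      requires a nonnegative error.\<close>
    moreover have "0 \<le> err \<alpha>" using lower[OF c] by linarith
    ultimately have "err \<alpha> = 29/624" by (simp add: ennreal_inj)
    with lower[OF c] show "\<alpha> = ?S1 \<or> \<alpha> = ?S2" by blast
  next
    assume "\<alpha> = ?S1 \<or> \<alpha> = ?S2"
    then have "card \<alpha> = 5" "err \<alpha> = 29/624" using card val by blast+
    then show "optimal_means P_ex 5 \<alpha>"
      by (simp add: optimal_means_def Q dist)
  qed
  with Q show ?thesis
    unfolding Av_2_3 means by blast
qed

end
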